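(* There exists a $5$-dimensional $0/1$-polytope $P\subset\mathbb R^5$ with $25$ vertices such that, for $\mathbf c_{\mathrm{lex}}=(2^1,2^2,2^3,2^4,2^5)$, the sequence $(N_\ell)_\ell$ of the numbers of $\mathbf c_{\mathrm{lex}}$-monotone paths of length $\ell$ on $P$ is not unimodal.
   Context: A $0/1$-polytope in $\mathbb R^n$ is a polytope all of whose vertices lie in $\{0,1\}^n$. For a polytope $P$ and $\mathbf c$ such that $\langle\cdot,\mathbf c\rangle$ attains its minimum and maximum over $P$ at unique vertices $v_{\min}$, $v_{\max}$, let $G_{P,\mathbf c}$ be the directed graph on the vertices of $P$ with an arc $u\to v$ whenever $[u,v]$ is an edge of $P$ with $\langle u,\mathbf c\rangle<\langle v,\mathbf c\rangle$. A $\mathbf c$-monotone path is a directed path in $G_{P,\mathbf c}$ from $v_{\min}$ to $v_{\max}$; its length is its number of edges, and $N_\ell$ is the number of such paths of length $\ell$. A finite sequence $(a_1,\dots,a_r)$ is unimodal if there is $k$ with $a_i\le a_{i+1}$ for $i<k$ and $a_i\ge a_{i+1}$ for $i\ge k$. *)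

theory Defs
  imports "HOL-Analysis.Analysis" "Graph_Theory.Arc_Walk"
begin

definition vertices :: "'a::euclidean_space set \<Rightarrow> 'a set" where
  "vertices P = {v. v extreme_point_of P}"

definition zero_one_polytope :: "(real ^ 'n) set \<Rightarrow> bool" where
  "zero_one_polytope P \<longleftrightarrow> polytope P \<and> (\<forall>v \<in> vertices P. \<forall>i. v $ i \<in> {0, 1})"

text \<open>The strict inequality says that the optimum over \<open>P\<close> is attained at \<open>v\<close> only.\<close>

definition unique_min_vertex :: "'a::euclidean_space set \<Rightarrow> 'a \<Rightarrow> 'a \<Rightarrow> bool" where
  "unique_min_vertex P c v \<longleftrightarrow> v \<in> vertices P \<and> (\<forall>x \<in> P - {v}. v \<bullet> c < x \<bullet> c)"

definition unique_max_vertex :: "'a::euclidean_space set \<Rightarrow> 'a \<Rightarrow> 'a \<Rightarrow> bool" where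
  "unique_max_vertex P c v \<longleftrightarrow> v \<in> vertices P \<and> (\<forall>x \<in> P - {v}. x \<bullet> c < v \<bullet> c)"

definition monotone_graph :: "'a::euclidean_space set \<Rightarrow> 'a \<Rightarrow> ('a, 'a \<times> 'a) pre_digraph" where
  "monotone_graph P c =
    \<lparr> verts = vertices P,
      arcs = {(u, v). u \<in> vertices P \<and> v \<in> vertices P \<and>
                closed_segment u v edge_of P \<and> u \<bullet> c < v \<bullet> c},
      tail = fst, head = snd \<rparr>"

text \<open>A path is the list of its arcs, so its \<open>length\<close> as a list is its number of edges.\<close>

definition monotone_paths :: "'a::euclidean_space set \<Rightarrow> 'a \<Rightarrow> ('a \<times> 'a) list set" where
  "monotone_paths P c =
    {p. \<exists>s t. unique_min_vertex P c s \<and> unique_max_vertex P c t \<and>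
          pre_digraph.apath (monotone_graph P c) s p t}"

definition num_monotone_paths :: "'a::euclidean_space set \<Rightarrow> 'a \<Rightarrow> nat \<Rightarrow> nat" where
  "num_monotone_paths P c l = card {p \<in> monotone_paths P c. length p = l}"

text \<open>The index runs from the shortest to the longest length of a monotone path, including any
  lengths in between that do not occur. Extending the range would only add zeros at the
  two ends, which does not affect unimodality of a sequence of natural numbers.\<close>

definition monotone_path_seq :: "'a::euclidean_space set \<Rightarrow> 'a \<Rightarrow> nat list" where
  "monotone_path_seq P c =
    map (num_monotone_paths P c)
      [Min (length ` monotone_paths P c) ..< Suc (Max (length ` monotone_paths P c))]"

definition unimodal :: "'a::linorder list \<Rightarrow> bool" where
  "unimodal a \<longleftrightarrow> (\<exists>k. \<forall>i. Suc i < length a \<longrightarrow>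
     (i < k \<longrightarrow> a ! i \<le> a ! Suc i) \<and> (k \<le> i \<longrightarrow> a ! i \<ge> a ! Suc i))"

definition c_lex :: "real ^ 5" where
  "c_lex = vector [2 ^ 1, 2 ^ 2, 2 ^ 3, 2 ^ 4, 2 ^ 5]"

end

theory Submission
  imports Defs
begin

text \<open>
  Remove the seven points with \<open>x\<^sub>1 = 0\<close>, \<open>x\<^sub>4 = 1\<close> other than \<open>(0, 1, 1, 1, 0)\<close> from the
  vertex set of the 5-cube. Encoding a 0/1-point as the number with binary digits
  \<open>x\<^sub>5 x\<^sub>4 x\<^sub>3 x\<^sub>2 x\<^sub>1\<close>, the objective \<open>c_lex\<close> is twice the code. A pair \<open>{u, v}\<close> spans an edge if some
  linear functional is minimised over the vertices exactly at \<open>u\<close> and \<open>v\<close>. It spans no edge if two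
  further vertices have the same midpoint, and here such vertices can always be found by flipping
  one coordinate in which \<open>u\<close> and \<open>v\<close> differ. This determines the monotone graph, and counting
  walks from \<open>0\<close> to \<open>31\<close> gives \<open>1, 7, 48, 127, 121, 162, 156, 72\<close> paths of lengths \<open>2, \<dots>, 9\<close>.
\<close>

section \<open>Faces of convex hulls of finite sets\<close>

text \<open>The level set of \<open>w\<close> through \<open>u\<close> contains the affine hull of
  \<open>{u, v}\<close>, while the hull of the remaining points lies strictly above it. This
  disjointness is the criterion of \<open>face_of_convex_hulls\<close>, and
  \<open>u \<noteq> v\<close> makes the face one-dimensional.\<close>

lemma closed_segment_edge_of_convex_hull:
  fixes S :: "'a::euclidean_space set"
  assumes "finite S" "u \<in> S" "v \<in> S" "u \<noteq> v" "w \<bullet> u = w \<bullet> v"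
    and less: "\<And>x. x \<in> S - {u, v} \<Longrightarrow> w \<bullet> u < w \<bullet> x"
  shows "closed_segment u v edge_of (convex hull S)"
proof -
  have "affine hull {u, v} \<subseteq> {x. w \<bullet> x = w \<bullet> u}"
    using assms by (intro hull_minimal affine_hyperplane) auto
  moreover have "convex hull (S - {u, v}) \<subseteq> {x. w \<bullet> x > w \<bullet> u}"
    using less by (intro hull_minimal convex_halfspace_gt) auto
  ultimately have "affine hull {u, v} \<inter> convex hull (S - {u, v}) = {}"
    by fastforce
  then have "convex hull {u, v} face_of convex hull S"
    using assms by (intro face_of_convex_hulls) auto
  then show ?thesis
    using \<open>u \<noteq> v\<close> by (simp add: edge_of_def segment_convex_hull aff_dim_convex_hull aff_dim_2)
qed

text \<open>Two segments with a common midpoint are the diagonals of a parallelogram. A face that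
  contains the midpoint of \<open>a\<close> and \<open>b\<close> must contain both of them, but the
  segment from \<open>u\<close> to \<open>v\<close> has no room for further extreme points.\<close>

lemma not_edge_of_if_sum_eq:
  fixes P :: "'a::euclidean_space set"
  assumes "a extreme_point_of P" "b extreme_point_of P" "u \<in> P" "v \<in> P"
    and ne: "a \<noteq> u" "a \<noteq> v" and sum: "a + b = u + v"
  shows "\<not> closed_segment u v edge_of P"
proof
  assume "closed_segment u v edge_of P"
  then have face: "closed_segment u v face_of P"
    by (simp add: edge_of_def)
  have "b \<noteq> u" "b \<noteq> v"
    using ne sum by (auto simp: add.commute)
  \<comment> \<open>An extreme point can lie on a segment between points of \<open>P\<close> only as
    one of its endpoints.\<close>
  then have "a \<notin> closed_segment u v" "b \<notin> closed_segment u v"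
    using assms by (auto simp: extreme_point_of_def open_segment_def)
  moreover have "midpoint a b \<in> closed_segment u v"
    using sum by (metis midpoint_def midpoint_in_closed_segment)
  \<comment> \<open>If \<open>a = b\<close>, the midpoint would be \<open>a\<close> itself, which is
    off the segment; so the midpoint is a proper one.\<close>
  ultimately have "midpoint a b \<in> open_segment a b"
    using midpoint_eq_endpoint midpoint_in_open_segment by metis
  then have "a \<in> closed_segment u v"
    using face \<open>midpoint a b \<in> closed_segment u v\<close> assms
    unfolding face_of_def extreme_point_of_def by blast
  then show False
    using \<open>a \<notin> closed_segment u v\<close> by simp
qed

text \<open>In the cube, \<open>v $ i\<close> and \<open>1 - v $ i\<close> are both combinations of
  nonnegative numbers with positive weights. One of the two vanishes, so all its summands vanish,
  which forces \<open>a\<close> and \<open>b\<close> to agree in coordinate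
  \<open>i\<close>.\<close>

lemma extreme_point_of_zero_one:
  fixes P :: "(real ^ 'n) set"
  assumes "P \<subseteq> cbox 0 1" "v \<in> P" "\<forall>i. v $ i \<in> {0, 1}"
  shows "v extreme_point_of P"
  unfolding extreme_point_of_def
proof (intro conjI ballI notI)
  fix a b assume ab: "a \<in> P" "b \<in> P" "v \<in> open_segment a b"
  then obtain t where t: "a \<noteq> b" "0 < t" "t < 1" "v = (1 - t) *\<^sub>R a + t *\<^sub>R b"
    by (auto simp: in_segment)
  have "a $ i = b $ i" for i
  proof -
    have "0 \<le> a $ i" "a $ i \<le> 1" "0 \<le> b $ i" "b $ i \<le> 1"
      using ab assms by (auto simp: mem_box_cart subset_iff)
    then have nonneg: "0 \<le> (1 - t) * a $ i" "0 \<le> t * b $ i"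
        "0 \<le> (1 - t) * (1 - a $ i)" "0 \<le> t * (1 - b $ i)"
      using t by auto
    have sum: "v $ i = (1 - t) * a $ i + t * b $ i"
        "1 - v $ i = (1 - t) * (1 - a $ i) + t * (1 - b $ i)"
      unfolding t(4) by (simp_all add: algebra_simps)
    consider "v $ i = 0" | "1 - v $ i = 0"
      using assms by force
    then have "(1 - t) * a $ i = 0 \<and> t * b $ i = 0 \<or>
        (1 - t) * (1 - a $ i) = 0 \<and> t * (1 - b $ i) = 0"
      using sum nonneg by cases (simp_all add: add_nonneg_eq_0_iff)
    then show ?thesis
      using t by auto
  qed
  with t(1) show False
    by (simp add: vec_eq_iff)
qed (use assms in auto)

lemma convex_hull_zero_one_subset_cbox:
  fixes S :: "(real ^ 'n) set"
  assumes "\<And>v i. v \<in> S \<Longrightarrow> v $ i \<in> {0, 1}"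
  shows "convex hull S \<subseteq> cbox 0 1"
proof -
  have "0 \<le> v $ i \<and> v $ i \<le> 1" if "v \<in> S" for v i
    using assms[OF that, of i] by auto
  then have "S \<subseteq> cbox 0 1"
    by (auto simp: mem_box_cart)
  then show "convex hull S \<subseteq> cbox 0 1"
    by (intro hull_minimal convex_box)
qed

text \<open>The points of \<open>S\<close> are corners of a cube containing the hull, so none of
  them is lost as a vertex. Vertices of the polytope can therefore be handled as a plain finite
  set.\<close>

lemma vertices_convex_hull_zero_one:
  fixes S :: "(real ^ 'n) set"
  assumes "\<And>v i. v \<in> S \<Longrightarrow> v $ i \<in> {0, 1}"
  shows "vertices (convex hull S) = S"
proof
  show "vertices (convex hull S) \<subseteq> S"
    using extreme_point_of_convex_hull by (auto simp: vertices_def)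
  have "convex hull S \<subseteq> cbox 0 1"
    using assms by (rule convex_hull_zero_one_subset_cbox)
  then show "S \<subseteq> vertices (convex hull S)"
    using assms by (auto simp: vertices_def intro!: extreme_point_of_zero_one hull_inc)
qed


section \<open>Monotone paths\<close>

lemma fin_digraph_monotone_graph:
  assumes "finite (vertices P)"
  shows "fin_digraph (monotone_graph P c)"
proof
  show "finite (arcs (monotone_graph P c))"
    by (rule finite_subset[of _ "vertices P \<times> vertices P"])
      (use assms in \<open>auto simp: monotone_graph_def\<close>)
qed (use assms in \<open>auto simp: monotone_graph_def\<close>)

text \<open>The objective strictly increases along every arc, so a walk cannot revisit a vertex.
  Counting paths thus becomes counting walks, which satisfy a simple recursion.\<close>

lemma apath_monotone_graph_iff:
  assumes "finite (vertices P)"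
  shows "pre_digraph.apath (monotone_graph P c) u p v \<longleftrightarrow>
    pre_digraph.awalk (monotone_graph P c) u p v"
proof -
  interpret fin_digraph "monotone_graph P c"
    by (rule fin_digraph_monotone_graph) fact
  \<comment> \<open>The lower bound \<open>u \<bullet> c\<close> is carried along so that a new
    first vertex is known to lie below all later ones, not just below its neighbour.\<close>
  have "sorted_wrt (\<lambda>x y. x \<bullet> c < y \<bullet> c) (awalk_verts u p) \<and>
      (\<forall>x \<in> set (awalk_verts u p). u \<bullet> c \<le> x \<bullet> c)"
    if "awalk u p v"
    using that
  proof (induction p arbitrary: u)
    case (Cons e p)
    let ?h = "head (monotone_graph P c) e"
    have "tail (monotone_graph P c) e = u" "u \<bullet> c < ?h \<bullet> c" and walk: "awalk ?h p v"
      using Cons.prems unfolding awalk_Cons_iff by (auto simp: monotone_graph_def)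
    then show ?case
      using Cons.IH[OF walk] by fastforce
  qed simp
  moreover have "distinct xs" if "sorted_wrt (\<lambda>x y. x \<bullet> c < y \<bullet> c) xs" for xs
    using that by (induction xs) auto
  ultimately show ?thesis
    by (auto simp: apath_def)
qed

lemma unique_min_vertex_unique:
  assumes "vertices P \<subseteq> P" "unique_min_vertex P c s" "unique_min_vertex P c s'"
  shows "s = s'"
proof (rule ccontr)
  assume "s \<noteq> s'"
  then have "s \<bullet> c < s' \<bullet> c" "s' \<bullet> c < s \<bullet> c"
    using assms by (auto simp: unique_min_vertex_def)
  then show False
    by simp
qed

lemma unique_max_vertex_unique:
  assumes "vertices P \<subseteq> P" "unique_max_vertex P c s" "unique_max_vertex P c s'"
  shows "s = s'"
proof (rule ccontr)
  assume "s \<noteq> s'"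
  then have "s \<bullet> c < s' \<bullet> c" "s' \<bullet> c < s \<bullet> c"
    using assms by (auto simp: unique_max_vertex_def)
  then show False
    by simp
qed

text \<open>Both optima are unique, so the existential over endpoints collapses to the given
  \<open>s\<close> and \<open>t\<close>.\<close>

lemma monotone_paths_eq:
  assumes "finite (vertices P)" "unique_min_vertex P c s" "unique_max_vertex P c t"
  shows "monotone_paths P c = {p. pre_digraph.awalk (monotone_graph P c) s p t}"
proof -
  have "vertices P \<subseteq> P"
    by (auto simp: vertices_def extreme_point_of_def)
  then have "unique_min_vertex P c s' \<longleftrightarrow> s' = s" "unique_max_vertex P c t' \<longleftrightarrow> t' = t" for s' t'
    using assms(2,3) by (auto intro: unique_min_vertex_unique unique_max_vertex_unique)
  then show ?thesis
    by (simp add: monotone_paths_def apath_monotone_graph_iff assms(1))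
qed

text \<open>Finiteness gives meaning to the \<open>Min\<close> and \<open>Max\<close> that delimit
  \<open>monotone_path_seq\<close>.\<close>

lemma finite_monotone_paths:
  assumes "finite (vertices P)" "unique_min_vertex P c s" "unique_max_vertex P c t"
  shows "finite (monotone_paths P c)"
proof -
  interpret fin_digraph "monotone_graph P c"
    by (rule fin_digraph_monotone_graph) fact
  show ?thesis
    using apaths_finite[of s t]
    by (simp add: monotone_paths_eq[OF assms] apath_monotone_graph_iff assms)
qed

text \<open>Serves both optima over a subset of the unit cube: applied to \<open>x\<close> it puts
  the minimum at \<open>0\<close>, applied to \<open>1 - x\<close> it puts the maximum at
  \<open>1\<close>.\<close>

lemma inner_vec_pos:
  fixes x c :: "real ^ 'n"
  assumes "x \<noteq> 0" "\<And>i. 0 \<le> x $ i" "\<And>i. 0 < c $ i"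
  shows "0 < x \<bullet> c"
proof -
  obtain j where "x $ j \<noteq> 0"
    using \<open>x \<noteq> 0\<close> by (auto simp: vec_eq_iff)
  then have "0 < x $ j * c $ j"
    using assms by (simp add: less_le)
  then show ?thesis
    unfolding inner_vec_def
    using assms by (intro sum_pos2[of _ j]) (auto simp: less_imp_le)
qed

lemma unique_min_vertex_0:
  fixes P :: "(real ^ 'n) set"
  assumes "0 \<in> vertices P" "P \<subseteq> cbox 0 1" "\<And>i. 0 < c $ i"
  shows "unique_min_vertex P c 0"
  unfolding unique_min_vertex_def
proof (intro conjI ballI)
  fix x assume "x \<in> P - {0}"
  then have "0 < x \<bullet> c"
    using assms by (intro inner_vec_pos) (auto simp: mem_box_cart subset_iff)
  then show "0 \<bullet> c < x \<bullet> c"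
    by simp
qed fact

lemma unique_max_vertex_1:
  fixes P :: "(real ^ 'n) set"
  assumes "1 \<in> vertices P" "P \<subseteq> cbox 0 1" "\<And>i. 0 < c $ i"
  shows "unique_max_vertex P c 1"
  unfolding unique_max_vertex_def
proof (intro conjI ballI)
  fix x assume "x \<in> P - {1}"
  then have "0 < (1 - x) \<bullet> c"
    using assms by (intro inner_vec_pos) (auto simp: mem_box_cart subset_iff)
  then show "x \<bullet> c < 1 \<bullet> c"
    by (simp add: inner_diff_left)
qed fact

text \<open>A strict descent followed at once by a strict ascent contradicts every choice of the
  peak \<open>k\<close>.\<close>

lemma not_unimodal_monotone_path_seq:
  assumes fin: "finite (monotone_paths P c)"
    and less: "num_monotone_paths P c (Suc l) < num_monotone_paths P c l"
      "num_monotone_paths P c (Suc l) < num_monotone_paths P c (Suc (Suc l))"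
  shows "\<not> unimodal (monotone_path_seq P c)"
proof
  let ?L = "length ` monotone_paths P c"
  have occurs: "m \<in> ?L" if "0 < num_monotone_paths P c m" for m
  proof -
    have "{p \<in> monotone_paths P c. length p = m} \<noteq> {}"
      using that by (auto simp: num_monotone_paths_def card_gt_0_iff)
    then show ?thesis
      by blast
  qed
  \<comment> \<open>The counts at \<open>l\<close> and \<open>Suc (Suc l)\<close> exceed another
    natural number, hence are positive. So both lengths occur and the whole dip falls inside the
    index range.\<close>
  have bounds: "Min ?L \<le> l" "Suc (Suc l) \<le> Max ?L"
    using fin less occurs by simp_all
  \<comment> \<open>The list starts at the shortest length, so length \<open>m\<close> sits at
    position \<open>m - Min ?L\<close>.\<close>
  have nth: "monotone_path_seq P c ! (m - Min ?L) = num_monotone_paths P c m"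
    if "Min ?L \<le> m" "m \<le> Max ?L" for m
    using that by (simp add: monotone_path_seq_def del: upt_Suc)
  have len: "length (monotone_path_seq P c) = Suc (Max ?L) - Min ?L"
    by (simp add: monotone_path_seq_def del: upt_Suc)
  assume "unimodal (monotone_path_seq P c)"
  then obtain k where
    k: "\<And>i. Suc i < length (monotone_path_seq P c) \<Longrightarrow>
      (i < k \<longrightarrow> monotone_path_seq P c ! i \<le> monotone_path_seq P c ! Suc i) \<and>
      (k \<le> i \<longrightarrow> monotone_path_seq P c ! i \<ge> monotone_path_seq P c ! Suc i)"
    unfolding unimodal_def by blast
  define i where "i = l - Min ?L"
  have i: "Suc l - Min ?L = Suc i" "Suc (Suc l) - Min ?L = Suc (Suc i)"
      "Suc (Suc i) < length (monotone_path_seq P c)"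
    using bounds by (simp_all add: i_def len Suc_diff_le)
  then have "monotone_path_seq P c ! Suc i < monotone_path_seq P c ! i"
      "monotone_path_seq P c ! Suc i < monotone_path_seq P c ! Suc (Suc i)"
    using nth[of l] nth[of "Suc l"] nth[of "Suc (Suc l)"] bounds less by (simp_all add: i_def)
  \<comment> \<open>If \<open>i < k\<close>, the descent at \<open>i\<close> is forbidden; if
    \<open>k \<le> i\<close>, then also \<open>k \<le> Suc i\<close>, and the ascent at
    \<open>Suc i\<close> is forbidden.\<close>
  then show False
    using k[of i] k[of "Suc i"] i(3) by linarith
qed


section \<open>Vectors with five components\<close>

lemma exhaust_5:
  fixes x :: 5
  shows "x = 1 \<or> x = 2 \<or> x = 3 \<or> x = 4 \<or> x = 5"
proof (induct x)
  case (of_int z)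
  \<comment> \<open>The type \<open>5\<close> is the integers modulo 5, so the representative 0 is
    the index written \<open>5\<close>.\<close>
  then have "z = 0 \<or> z = 1 \<or> z = 2 \<or> z = 3 \<or> z = 4"
    by auto
  then show ?case
    by auto
qed

lemma forall_5: "(\<forall>i::5. P i) \<longleftrightarrow> P 1 \<and> P 2 \<and> P 3 \<and> P 4 \<and> P 5"
  by (metis exhaust_5)

lemma UNIV_5: "UNIV = {1, 2, 3, 4, 5::5}"
  using exhaust_5 by auto

lemma sum_5: "sum f (UNIV::5 set) = f 1 + f 2 + f 3 + f 4 + f 5"
  unfolding UNIV_5 by (simp add: ac_simps)

lemma vector_5 [simp]:
  "(vector [a, b, c, d, e] :: 'a::zero ^ 5) $ 1 = a"
  "(vector [a, b, c, d, e] :: 'a::zero ^ 5) $ 2 = b"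
  "(vector [a, b, c, d, e] :: 'a::zero ^ 5) $ 3 = c"
  "(vector [a, b, c, d, e] :: 'a::zero ^ 5) $ 4 = d"
  "(vector [a, b, c, d, e] :: 'a::zero ^ 5) $ 5 = e"
  unfolding vector_def by simp_all

lemma inner_vector_5 [simp]:
  "(vector [a, b, c, d, e] :: real ^ 5) \<bullet> vector [a', b', c', d', e'] =
    a * a' + b * b' + c * c' + d * d' + e * e'"
  by (simp add: inner_vec_def sum_5)


section \<open>The polytope\<close>

definition cube_point :: "nat \<Rightarrow> real ^ 5" where
  "cube_point n = vector [of_bool (bit n 0), of_bool (bit n 1), of_bool (bit n 2),
     of_bool (bit n 3), of_bool (bit n 4)]"

definition vertex_codes :: "nat list" where
  "vertex_codes = [0, 1, 2, 3, 4, 5, 6, 7, 9, 11, 13, 14, 15, 16, 17, 18, 19, 20, 21,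
     22, 23, 25, 27, 29, 31]"

text \<open>An entry \<open>(v, w)\<close> in the row of \<open>u\<close> stands for an edge from \<open>u\<close> to \<open>v\<close>, where \<open>w\<close> lists the
  coefficients of a linear functional that is minimised over the vertices exactly at \<open>u\<close> and \<open>v\<close>.\<close>

definition edge_table :: "(nat \<times> (nat \<times> real list) list) list" where
  "edge_table = [
    (0, [(1, [0, 1, 1, 1, 1]), (2, [1, 0, 1, 0, 1]), (4, [1, 1, 0, 0, 1]), (9, [1, 1, 1, -1, 1]),
      (14, [3, 1, 1, -2, 1]), (16, [1, 1, 1, 0, 0])]),
    (1, [(3, [-1, 0, 1, 1, 1]), (5, [-1, 1, 0, 1, 1]), (9, [-1, 1, 1, 0, 1]),
      (17, [-1, 1, 1, 1, 0])]),
    (2, [(3, [0, -1, 1, 1, 1]), (6, [1, -1, 0, 1, 1]), (11, [1, -1, 2, -1, 1]),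
      (14, [2, -1, 1, -1, 1]), (18, [1, -1, 1, 0, 0])]),
    (3, [(7, [-1, -1, 0, 1, 1]), (11, [-1, -1, 1, 0, 1]), (19, [-1, -1, 1, 1, 0])]),
    (4, [(5, [0, 1, -1, 1, 1]), (6, [1, 0, -1, 1, 1]), (13, [1, 2, -1, -1, 1]),
      (14, [2, 1, -1, -1, 1]), (20, [1, 1, -1, 0, 0])]),
    (5, [(7, [-1, 0, -1, 1, 1]), (13, [-1, 1, -1, 0, 1]), (21, [-1, 1, -1, 1, 0])]),
    (6, [(7, [0, -1, -1, 1, 1]), (14, [1, -1, -1, 0, 1]), (22, [1, -1, -1, 1, 0])]),
    (7, [(15, [-1, -1, -1, 0, 1]), (23, [-1, -1, -1, 1, 0])]),
    (9, [(11, [0, 0, 1, -1, 1]), (13, [0, 1, 0, -1, 1]), (14, [2, 1, 1, -3, 1]),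
      (25, [0, 1, 1, -1, 0])]),
    (11, [(14, [1, -1, 1, -2, 1]), (15, [-1, -1, 0, -1, 1]), (27, [0, -1, 1, -1, 0])]),
    (13, [(14, [1, 1, -1, -2, 1]), (15, [-1, 0, -1, -1, 1]), (29, [0, 1, -1, -1, 0])]),
    (14, [(15, [0, -1, -1, -1, 1]), (16, [4, 1, 1, -3, -1]), (18, [3, -1, 1, -2, -1]),
      (20, [3, 1, -1, -2, -1]), (22, [2, -1, -1, -1, -1]), (25, [3, 1, 1, -4, -1]),
      (27, [2, -1, 1, -3, -1]), (29, [2, 1, -1, -3, -1]), (31, [1, -1, -1, -2, -1])]),
    (15, [(31, [-1, -1, -1, -1, 0])]),
    (16, [(17, [0, 1, 1, 1, -1]), (18, [1, 0, 1, 0, -1]), (20, [1, 1, 0, 0, -1]),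
      (25, [1, 1, 1, -1, -1])]),
    (17, [(19, [-1, 0, 1, 1, -1]), (21, [-1, 1, 0, 1, -1]), (25, [-1, 1, 1, 0, -1])]),
    (18, [(19, [0, -1, 1, 1, -1]), (22, [1, -1, 0, 0, -1]), (27, [1, -1, 1, -1, -1])]),
    (19, [(23, [-1, -1, 0, 1, -1]), (27, [-1, -1, 1, 0, -1])]),
    (20, [(21, [0, 1, -1, 1, -1]), (22, [1, 0, -1, 0, -1]), (29, [1, 1, -1, -1, -1])]),
    (21, [(23, [-1, 0, -1, 1, -1]), (29, [-1, 1, -1, 0, -1])]),
    (22, [(23, [0, -1, -1, 1, -1]), (31, [1, -1, -1, -1, -2])]),
    (23, [(31, [-1, -1, -1, 0, -1])]),
    (25, [(27, [0, 0, 1, -1, -1]), (29, [0, 1, 0, -1, -1])]),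
    (27, [(31, [0, -1, 0, -1, -1])]),
    (29, [(31, [0, 0, -1, -1, -1])])]"

text \<open>Among the vertex codes the default \<open>[]\<close> concerns only \<open>31\<close>,
  the maximum, which has no row in the table.\<close>

definition successors :: "nat \<Rightarrow> nat list" where
  "successors n = (case map_of edge_table n of None \<Rightarrow> [] | Some vs \<Rightarrow> map fst vs)"

definition vertex_set :: "(real ^ 5) set" where
  "vertex_set = cube_point ` set vertex_codes"

section \<open>Vertices and dimension of the polytope\<close>

lemma cube_point_nth: "cube_point n $ i \<in> {0, 1}"
  using exhaust_5[of i] by (auto simp: cube_point_def)

lemma cube_point_0: "cube_point 0 = 0"
  by (simp add: cube_point_def vec_eq_iff forall_5)

lemma cube_point_31: "cube_point 31 = 1"
  by (simp add: cube_point_def bit_Suc_0_iff vec_eq_iff forall_5)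

lemma vertex_set_nth: "v \<in> vertex_set \<Longrightarrow> v $ i \<in> {0, 1}"
  using cube_point_nth by (auto simp: vertex_set_def)

lemma vertices_convex_hull_vertex_set: "vertices (convex hull vertex_set) = vertex_set"
  using vertex_set_nth by (rule vertices_convex_hull_zero_one)

lemma cube_point_simps:
  "cube_point 0 = vector [0, 0, 0, 0, 0]"
  "cube_point (Suc 0) = vector [1, 0, 0, 0, 0]"
  "cube_point 2 = vector [0, 1, 0, 0, 0]"
  "cube_point 3 = vector [1, 1, 0, 0, 0]"
  "cube_point 4 = vector [0, 0, 1, 0, 0]"
  "cube_point 5 = vector [1, 0, 1, 0, 0]"
  "cube_point 6 = vector [0, 1, 1, 0, 0]"
  "cube_point 7 = vector [1, 1, 1, 0, 0]"
  "cube_point 9 = vector [1, 0, 0, 1, 0]"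
  "cube_point 11 = vector [1, 1, 0, 1, 0]"
  "cube_point 13 = vector [1, 0, 1, 1, 0]"
  "cube_point 14 = vector [0, 1, 1, 1, 0]"
  "cube_point 15 = vector [1, 1, 1, 1, 0]"
  "cube_point 16 = vector [0, 0, 0, 0, 1]"
  "cube_point 17 = vector [1, 0, 0, 0, 1]"
  "cube_point 18 = vector [0, 1, 0, 0, 1]"
  "cube_point 19 = vector [1, 1, 0, 0, 1]"
  "cube_point 20 = vector [0, 0, 1, 0, 1]"
  "cube_point 21 = vector [1, 0, 1, 0, 1]"
  "cube_point 22 = vector [0, 1, 1, 0, 1]"
  "cube_point 23 = vector [1, 1, 1, 0, 1]"
  "cube_point 25 = vector [1, 0, 0, 1, 1]"
  "cube_point 27 = vector [1, 1, 0, 1, 1]"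
  "cube_point 29 = vector [1, 0, 1, 1, 1]"
  "cube_point 31 = vector [1, 1, 1, 1, 1]"
  by (simp_all add: cube_point_def bit_Suc_0_iff)

lemma successors_simps:
  "successors 0 = [1, 2, 4, 9, 14, 16]"
  "successors (Suc 0) = [3, 5, 9, 17]"
  "successors 2 = [3, 6, 11, 14, 18]"
  "successors 3 = [7, 11, 19]"
  "successors 4 = [5, 6, 13, 14, 20]"
  "successors 5 = [7, 13, 21]"
  "successors 6 = [7, 14, 22]"
  "successors 7 = [15, 23]"
  "successors 9 = [11, 13, 14, 25]"
  "successors 11 = [14, 15, 27]"
  "successors 13 = [14, 15, 29]"
  "successors 14 = [15, 16, 18, 20, 22, 25, 27, 29, 31]"
  "successors 15 = [31]"
  "successors 16 = [17, 18, 20, 25]"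
  "successors 17 = [19, 21, 25]"
  "successors 18 = [19, 22, 27]"
  "successors 19 = [23, 27]"
  "successors 20 = [21, 22, 29]"
  "successors 21 = [23, 29]"
  "successors 22 = [23, 31]"
  "successors 23 = [31]"
  "successors 25 = [27, 29]"
  "successors 27 = [31]"
  "successors 29 = [31]"
  "successors 31 = []"
  by (simp_all add: successors_def edge_table_def)

text \<open>The entries of \<open>c_lex\<close> are twice the binary place values, so the objective
  orders vertices by code. This turns the direction of arcs into \<open><\<close> on codes and makes
  \<open>cube_point\<close> injective on them.\<close>

lemma c_lex_inner_cube_point:
  assumes "n \<in> set vertex_codes"
  shows "cube_point n \<bullet> c_lex = 2 * real n"
proof -
  have "list_all (\<lambda>n. cube_point n \<bullet> c_lex = 2 * real n) vertex_codes"
    by (simp add: vertex_codes_def cube_point_simps c_lex_def)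
  then show ?thesis
    using assms by (simp add: list_all_iff)
qed

lemma inj_on_cube_point: "inj_on cube_point (set vertex_codes)"
proof (rule inj_onI)
  fix m n assume "m \<in> set vertex_codes" "n \<in> set vertex_codes" "cube_point m = cube_point n"
  then have "2 * real m = 2 * real n"
    by (metis c_lex_inner_cube_point)
  then show "m = n"
    by simp
qed

lemma finite_vertex_set: "finite vertex_set"
  by (simp add: vertex_set_def)

lemma card_vertex_set: "card vertex_set = 25"
proof -
  have "card vertex_set = card (set vertex_codes)"
    unfolding vertex_set_def by (rule card_image[OF inj_on_cube_point])
  also have "\<dots> = 25"
    by (simp add: vertex_codes_def)
  finally show ?thesis .
qed

lemma aff_dim_vertex_set: "aff_dim (convex hull vertex_set) = 5"
proof -
  have in_set: "cube_point n \<in> vertex_set" if "n \<in> {0, 1, 2, 4, 9, 16}" for n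
    using that by (auto simp: vertex_set_def vertex_codes_def)
  have "0 \<in> vertex_set"
    using in_set[of 0] by (simp add: cube_point_0)
  have "x \<in> span vertex_set" for x :: "real ^ 5"
  proof -
    \<comment> \<open>Four of the standard basis vectors are vertices. The fourth basis vector has
      code 8, which was removed, so it is written as the difference of the points with codes 9 and
      1.\<close>
    have "\<forall>i. x $ i = (x $ 1 *\<^sub>R cube_point 1 + x $ 2 *\<^sub>R cube_point 2 + x $ 3 *\<^sub>R cube_point 4 +
        x $ 4 *\<^sub>R (cube_point 9 - cube_point 1) + x $ 5 *\<^sub>R cube_point 16) $ i"
      unfolding forall_5 by (simp add: cube_point_def bit_Suc_0_iff)
    then have "x = x $ 1 *\<^sub>R cube_point 1 + x $ 2 *\<^sub>R cube_point 2 + x $ 3 *\<^sub>R cube_point 4 +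
        x $ 4 *\<^sub>R (cube_point 9 - cube_point 1) + x $ 5 *\<^sub>R cube_point 16"
      unfolding vec_eq_iff .
    also have "\<dots> \<in> span vertex_set"
      by (intro span_add span_scale span_diff span_base in_set) auto
    finally show ?thesis .
  qed
  then have "span vertex_set = UNIV"
    by blast
  then have "dim vertex_set = 5"
    using dim_span[of vertex_set] dim_UNIV[where 'a="real ^ 5"] by simp
  with \<open>0 \<in> vertex_set\<close> show ?thesis
    by (simp add: aff_dim_convex_hull aff_dim_zero hull_inc)
qed

section \<open>Edges and non-edges\<close>

lemma edge_table_certified:
  "list_all (\<lambda>(u, vs). list_all (\<lambda>(v, w).
      u \<in> set vertex_codes \<and> v \<in> set vertex_codes \<and> u < v \<and>
      vector w \<bullet> cube_point u = vector w \<bullet> cube_point v \<and>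
      list_all (\<lambda>x. x = u \<or> x = v \<or> vector w \<bullet> cube_point u < vector w \<bullet> cube_point x) vertex_codes)
    vs) edge_table"
  by (simp add: edge_table_def vertex_codes_def cube_point_simps)

text \<open>Flipping bit \<open>k\<close> in both codes produces the second pair with the same
  midpoint. The condition \<open>flip_bit k u \<noteq> v\<close> excludes codes that differ in bit
  \<open>k\<close> alone, where flipping merely swaps \<open>u\<close> and \<open>v\<close>.\<close>

lemma non_successors_flip_bit:
  "list_all (\<lambda>u. list_all (\<lambda>v. u < v \<longrightarrow> v \<in> set (successors u) \<or>
      (\<exists>k \<in> {0, 1, 2, 3, 4}. bit u k \<noteq> bit v k \<and> flip_bit k u \<noteq> v \<and>
         flip_bit k u \<in> set vertex_codes \<and> flip_bit k v \<in> set vertex_codes))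
    vertex_codes) vertex_codes"
  by (simp add: successors_simps vertex_codes_def flip_bit_eq_xor bit_Suc_0_iff)

text \<open>Where \<open>u\<close> and \<open>v\<close> differ in bit \<open>k\<close>, flipping it
  in both exchanges a 0 and a 1, which leaves the sum of that coordinate unchanged.\<close>

lemma cube_point_flip_bit:
  assumes "bit u k \<noteq> bit v k"
  shows "cube_point (flip_bit k u) + cube_point (flip_bit k v) = cube_point u + cube_point v"
  using assms by (auto simp: cube_point_def vec_eq_iff forall_5 bit_flip_bit_iff)

lemma successors_certificate:
  assumes "v \<in> set (successors u)"
  obtains w :: "real ^ 5" where "u \<in> set vertex_codes" "v \<in> set vertex_codes" "u < v"
    "w \<bullet> cube_point u = w \<bullet> cube_point v"
    "\<And>x. x \<in> set vertex_codes \<Longrightarrow> x \<noteq> u \<Longrightarrow> x \<noteq> v \<Longrightarrow> w \<bullet> cube_point u < w \<bullet> cube_point x"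
proof -
  obtain vs where vs: "map_of edge_table u = Some vs" "v \<in> fst ` set vs"
    using assms by (cases "map_of edge_table u") (auto simp: successors_def)
  then obtain w where w: "(v, w) \<in> set vs"
    by auto
  have "(u, vs) \<in> set edge_table"
    using vs by (simp add: map_of_SomeD)
  then show thesis
    using edge_table_certified w that[of "vector w"] unfolding list_all_iff by fastforce
qed

lemma edge_of_iff_successor:
  assumes "u \<in> set vertex_codes" "v \<in> set vertex_codes" "u < v"
  shows "closed_segment (cube_point u) (cube_point v) edge_of (convex hull vertex_set) \<longleftrightarrow>
    v \<in> set (successors u)"
proof
  assume "v \<in> set (successors u)"
  then obtain w where w: "w \<bullet> cube_point u = w \<bullet> cube_point v"
    "\<And>x. x \<in> set vertex_codes \<Longrightarrow> x \<noteq> u \<Longrightarrow> x \<noteq> v \<Longrightarrow> w \<bullet> cube_point u < w \<bullet> cube_point x"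
    using successors_certificate by metis
  show "closed_segment (cube_point u) (cube_point v) edge_of (convex hull vertex_set)"
  proof (rule closed_segment_edge_of_convex_hull[OF finite_vertex_set _ _ _ w(1)])
    show "cube_point u \<noteq> cube_point v"
      using assms inj_on_eq_iff[OF inj_on_cube_point] by auto
  qed (use assms w(2) in \<open>auto simp: vertex_set_def\<close>)
next
  assume edge: "closed_segment (cube_point u) (cube_point v) edge_of (convex hull vertex_set)"
  show "v \<in> set (successors u)"
  proof (rule ccontr)
    assume "v \<notin> set (successors u)"
    then obtain k where k: "bit u k \<noteq> bit v k" "flip_bit k u \<noteq> v"
        "flip_bit k u \<in> set vertex_codes" "flip_bit k v \<in> set vertex_codes"
      using non_successors_flip_bit assms unfolding list_all_iff by blast
    have "flip_bit k u \<noteq> u"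
      by (metis (full_types) bit_flip_bit_iff k(1) bit_iff_odd possible_bit_nat)
    then have ne: "cube_point (flip_bit k u) \<noteq> cube_point u" "cube_point (flip_bit k u) \<noteq> cube_point v"
      using k assms inj_on_eq_iff[OF inj_on_cube_point] by auto
    have extreme: "cube_point n extreme_point_of (convex hull vertex_set)" if "n \<in> set vertex_codes" for n
      using that vertices_convex_hull_vertex_set by (auto simp: vertices_def vertex_set_def)
    have "\<not> closed_segment (cube_point u) (cube_point v) edge_of (convex hull vertex_set)"
      using assms k ne
      by (intro not_edge_of_if_sum_eq[OF extreme extreme _ _ _ _ cube_point_flip_bit])
        (auto simp: vertex_set_def hull_inc)
    with edge show False
      by simp
  qed
qed

lemma arcs_monotone_graph_iff:
  assumes "u \<in> set vertex_codes"
  shows "(cube_point u, y) \<in> arcs (monotone_graph (convex hull vertex_set) c_lex) \<longleftrightarrow>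
    (\<exists>v \<in> set (successors u). y = cube_point v)"
proof -
  have "(cube_point u, y) \<in> arcs (monotone_graph (convex hull vertex_set) c_lex) \<longleftrightarrow>
    (\<exists>v \<in> set vertex_codes. y = cube_point v \<and> u < v \<and>
      closed_segment (cube_point u) (cube_point v) edge_of (convex hull vertex_set))"
    unfolding monotone_graph_def vertices_convex_hull_vertex_set
    using assms by (auto simp: vertex_set_def c_lex_inner_cube_point)
  also have "\<dots> \<longleftrightarrow> (\<exists>v \<in> set (successors u). y = cube_point v)"
    using assms edge_of_iff_successor successors_certificate by metis
  finally show ?thesis .
qed

text \<open>Ensures that the list sum in \<open>count_walks\<close> counts every arc once.\<close>

lemma distinct_successors:
  assumes "u \<in> set vertex_codes"
  shows "distinct (successors u)"
proof -
  have "list_all (\<lambda>u. distinct (successors u)) vertex_codes"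
    by (simp add: successors_simps vertex_codes_def)
  then show ?thesis
    using assms by (simp add: list_all_iff)
qed

section \<open>Counting walks to the maximum\<close>

primrec count_walks :: "nat \<Rightarrow> nat \<Rightarrow> nat" where
  "count_walks 0 u = of_bool (u = 31)"
| "count_walks (Suc l) u = (\<Sum>v\<leftarrow>successors u. count_walks l v)"

text \<open>A walk of length \<open>Suc l\<close> splits uniquely into its first arc and a walk of
  length \<open>l\<close> from a successor. Finiteness is part of the induction because the
  cardinality of the union of these classes depends on it.\<close>

lemma card_awalks:
  fixes l u :: nat
  defines "W \<equiv> \<lambda>l u. {p. pre_digraph.awalk (monotone_graph (convex hull vertex_set) c_lex)
    (cube_point u) p (cube_point 31) \<and> length p = l}"
  assumes "u \<in> set vertex_codes"
  shows "finite (W l u) \<and> card (W l u) = count_walks l u"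
  using assms(2)
proof (induction l arbitrary: u)
  let ?G = "monotone_graph (convex hull vertex_set) c_lex"
  interpret fin_digraph ?G
    by (rule fin_digraph_monotone_graph)
      (simp add: vertices_convex_hull_vertex_set finite_vertex_set)
  {
    case 0
    have 31: "31 \<in> set vertex_codes"
      by (simp add: vertex_codes_def)
    then have "cube_point 31 \<in> verts ?G"
      by (simp add: monotone_graph_def vertices_convex_hull_vertex_set) (simp add: vertex_set_def)
    then have "W 0 u = (if u = 31 then {[]} else {})"
      using 0 31 inj_on_eq_iff[OF inj_on_cube_point, of u 31]
      by (auto simp: W_def awalk_Nil_iff)
    then show ?case
      by simp
  next
    case (Suc l)
    have ends: "tail ?G = fst" "head ?G = snd"
      by (simp_all add: monotone_graph_def)
    have W_Suc: "W (Suc l) u = (\<Union>v \<in> set (successors u). (#) (cube_point u, cube_point v) ` W l v)"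
    proof (intro set_eqI iffI)
      fix p assume "p \<in> W (Suc l) u"
      then obtain y q where p: "p = (cube_point u, y) # q" "(cube_point u, y) \<in> arcs ?G"
          "awalk y q (cube_point 31)" "length q = l"
        by (cases p) (auto simp: W_def awalk_Cons_iff ends)
      then obtain v where "v \<in> set (successors u)" "y = cube_point v"
        using arcs_monotone_graph_iff[OF Suc.prems] by blast
      then show "p \<in> (\<Union>v \<in> set (successors u). (#) (cube_point u, cube_point v) ` W l v)"
        using p by (simp add: W_def image_iff) blast
    next
      fix p assume "p \<in> (\<Union>v \<in> set (successors u). (#) (cube_point u, cube_point v) ` W l v)"
      then obtain v q where v: "v \<in> set (successors u)" "p = (cube_point u, cube_point v) # q" "q \<in> W l v"
        by auto
      then have "(cube_point u, cube_point v) \<in> arcs ?G"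
        using arcs_monotone_graph_iff[OF Suc.prems] by blast
      then show "p \<in> W (Suc l) u"
        using v by (simp add: W_def awalk_Cons_iff ends)
    qed
    have succ: "v \<in> set vertex_codes" if "v \<in> set (successors u)" for v
      using that by (rule successors_certificate)
    then have IH: "finite (W l v)" "card (W l v) = count_walks l v" if "v \<in> set (successors u)" for v
      using Suc.IH that by auto
    have "card (W (Suc l) u) = (\<Sum>v \<in> set (successors u). card ((#) (cube_point u, cube_point v) ` W l v))"
      unfolding W_Suc
    proof (rule card_UN_disjoint)
      \<comment> \<open>Walks through different successors differ already in their first arc, since
        \<open>cube_point\<close> is injective on the codes.\<close>
      show "\<forall>v \<in> set (successors u). \<forall>v' \<in> set (successors u). v \<noteq> v' \<longrightarrow>
          (#) (cube_point u, cube_point v) ` W l v \<inter> (#) (cube_point u, cube_point v') ` W l v' = {}"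
        using succ inj_on_eq_iff[OF inj_on_cube_point] by auto
    qed (use IH in auto)
    also have "\<dots> = (\<Sum>v \<in> set (successors u). count_walks l v)"
      using IH by (intro sum.cong) (auto simp: card_image)
    also have "\<dots> = count_walks (Suc l) u"
      using distinct_successors[OF Suc.prems] by (simp add: sum_list_distinct_conv_sum_set)
    finally show ?case
      using IH by (simp add: W_Suc)
  }
qed

lemma count_walks_numeral:
  "count_walks (numeral k) u = (\<Sum>v\<leftarrow>successors u. count_walks (pred_numeral k) v)"
  by (simp add: numeral_eq_Suc)

text \<open>These consecutive terms contain the dip: 121 at length 6 lies below both of its
  neighbours.\<close>

lemma count_walks_values: "count_walks 5 0 = 127" "count_walks 6 0 = 121" "count_walks 7 0 = 162"
  by (simp_all add: count_walks_numeral successors_simps)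

lemma positive_c_lex: "0 < c_lex $ i"
  using exhaust_5[of i] by (auto simp: c_lex_def)

lemma num_monotone_paths_eq:
  "num_monotone_paths (convex hull vertex_set) c_lex l = count_walks l 0"
  and finite_monotone_paths_vertex_set: "finite (monotone_paths (convex hull vertex_set) c_lex)"
proof -
  let ?P = "convex hull vertex_set"
  have box: "?P \<subseteq> cbox 0 1"
    using vertex_set_nth by (rule convex_hull_zero_one_subset_cbox)
  have codes: "0 \<in> set vertex_codes" "31 \<in> set vertex_codes"
    by (simp_all add: vertex_codes_def)
  \<comment> \<open>The origin and the all-ones point are among the vertices kept, so the optima
    over the whole cube are also those over \<open>?P\<close>.\<close>
  then have "0 \<in> vertices ?P" "1 \<in> vertices ?P"
    unfolding vertices_convex_hull_vertex_set
    by (auto simp: vertex_set_def simp flip: cube_point_0 cube_point_31)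
  then have ends: "unique_min_vertex ?P c_lex (cube_point 0)" "unique_max_vertex ?P c_lex (cube_point 31)"
    unfolding cube_point_0 cube_point_31
    using unique_min_vertex_0[OF _ box positive_c_lex] unique_max_vertex_1[OF _ box positive_c_lex] by auto
  have fin: "finite (vertices ?P)"
    by (simp add: vertices_convex_hull_vertex_set finite_vertex_set)
  show "num_monotone_paths ?P c_lex l = count_walks l 0"
    using card_awalks[OF codes(1), of l]
    by (simp add: num_monotone_paths_def monotone_paths_eq[OF fin ends])
  show "finite (monotone_paths ?P c_lex)"
    by (rule finite_monotone_paths[OF fin ends])
qed

theorem theorem4p15:
  shows "\<exists>P :: (real ^ 5) set.
    zero_one_polytope P \<and> aff_dim P = 5 \<and> card (vertices P) = 25 \<and>
    \<not> unimodal (monotone_path_seq P c_lex)"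
proof (intro exI conjI)
  let ?P = "convex hull vertex_set"
  show "zero_one_polytope ?P"
    unfolding zero_one_polytope_def polytope_def vertices_convex_hull_vertex_set
    using finite_vertex_set vertex_set_nth by blast
  show "aff_dim ?P = 5"
    by (rule aff_dim_vertex_set)
  show "card (vertices ?P) = 25"
    by (simp add: vertices_convex_hull_vertex_set card_vertex_set)
  show "\<not> unimodal (monotone_path_seq ?P c_lex)"
    using not_unimodal_monotone_path_seq[OF finite_monotone_paths_vertex_set, of 5]
    by (simp add: num_monotone_paths_eq count_walks_values)
qed

end
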